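(* Let $V$ be a Hilbert space, fix a level $\ell$ and an estimation round $\mathtt i\ge1$, let $M_{\mathtt i-1,\ell}\ge1$ and $\Delta M_{\mathtt i,\ell}\ge 1$ be integers, set $M^{\mathrm{opt}}_{\mathtt i,\ell}=M_{\mathtt i-1,\ell}+\Delta M_{\mathtt i,\ell}$, and let $\mathbf v_\ell^{(1)},\dots,\mathbf v_\ell^{(M^{\mathrm{opt}}_{\mathtt i,\ell})}\in V$ be samples. Then the second order sum $z^2_{\mathtt i,\ell}[\mathbf v_\ell]$ (defined in the context) can be computed cumulatively by $$z^2_{\mathtt i,\ell}[\mathbf v_\ell]=z^2_{\mathtt i-1,\ell}[\mathbf v_\ell]+\Delta z^2_{\mathtt i,\ell}[\mathbf v_\ell]+\frac{M_{\mathtt i-1,\ell}\,\Delta M_{\mathtt i,\ell}}{M^{\mathrm{opt}}_{\mathtt i,\ell}}\,\|\delta_{\mathtt i,\ell}[\mathbf v_\ell]\|_V^2$$ with $$\delta_{\mathtt i,\ell}[\mathbf v_\ell]=\Delta E^{\mathrm{MC}}_{\mathtt i,\ell}[\mathbf v_\ell]-E^{\mathrm{MC}}_{\mathtt i-1,\ell}[\mathbf v_\ell],\qquad \Delta E^{\mathrm{MC}}_{\mathtt i,\ell}[\mathbf v_\ell]=\frac1{\Delta M_{\mathtt i,\ell}}\sum_{m=1+M_{\mathtt i-1,\ell}}^{M^{\mathrm{opt}}_{\mathtt i,\ell}}\mathbf v_\ell^{(m)}$$ and $$\Delta z^2_{\mathtt i,\ell}[\mathbf v_\ell]=\sum_{m=1+M_{\mathtt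 i-1,\ell}}^{M^{\mathrm{opt}}_{\mathtt i,\ell}}\left\|\mathbf v_\ell^{(m)}-\Delta E^{\mathrm{MC}}_{\mathtt i,\ell}[\mathbf v_\ell]\right\|_V^2 .$$
   Context: $M_{\mathtt i-1,\ell}$ is the number of samples on level $\ell$ accumulated up to round $\mathtt i-1$, $\Delta M_{\mathtt i,\ell}$ the number of new samples in round $\mathtt i$, and $M^{\mathrm{opt}}_{\mathtt i,\ell}=M_{\mathtt i,\ell}$ the accumulated number after round $\mathtt i$. The accumulated sample mean and second order sum after round $\mathtt i-1$ are $$E^{\mathrm{MC}}_{\mathtt i-1,\ell}[\mathbf v_\ell]=\frac1{M_{\mathtt i-1,\ell}}\sum_{m=1}^{M_{\mathtt i-1,\ell}}\mathbf v_\ell^{(m)},\qquad z^2_{\mathtt i-1,\ell}[\mathbf v_\ell]=\sum_{m=1}^{M_{\mathtt i-1,\ell}}\left\|\mathbf v_\ell^{(m)}-E^{\mathrm{MC}}_{\mathtt i-1,\ell}[\mathbf v_\ell]\right\|_V^2 ,$$ and those after round $\mathtt i$, namely $E^{\mathrm{MC}}_{\mathtt i,\ell}[\mathbf v_\ell]$ and $z^2_{\mathtt i,\ell}[\mathbf v_\ell]$, are defined by the same formulas with $M_{\mathtt i-1,\ell}$ replaced by $M^{\mathrm{opt}}_{\mathtt i,\ell}$. *)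

theory Defs
  imports "HOL-Analysis.Analysis"
begin

text \<open>
  Conventions: \<open>M i l\<close> is the number of samples on level \<open>l\<close> accumulated after round \<open>i\<close>,
  \<open>dM i l\<close> is the number of new samples drawn in round \<open>i\<close>, and \<open>v l m\<close> is the sample
  with number \<open>m\<close> on level \<open>l\<close>. Samples are numbered from 1, so \<open>v l 0\<close> is never used.
\<close>

definition E_MC :: "(nat \<Rightarrow> nat \<Rightarrow> nat) \<Rightarrow> (nat \<Rightarrow> nat \<Rightarrow> 'a::real_normed_vector) \<Rightarrow> nat \<Rightarrow> nat \<Rightarrow> 'a" where
  "E_MC M v i l = (1 / real (M i l)) *\<^sub>R (\<Sum>m = 1..M i l. v l m)"

definition z2 :: "(nat \<Rightarrow> nat \<Rightarrow> nat) \<Rightarrow> (nat \<Rightarrow> nat \<Rightarrow> 'a::real_normed_vector) \<Rightarrow> nat \<Rightarrow> nat \<Rightarrow> real" where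
  "z2 M v i l = (\<Sum>m = 1..M i l. (norm (v l m - E_MC M v i l))\<^sup>2)"

text \<open>
  The increments below compare round \<open>i\<close> with round \<open>i - 1\<close> and are meant for \<open>i \<ge> 1\<close> only,
  since subtraction on natural numbers truncates.
\<close>

definition Delta_E_MC :: "(nat \<Rightarrow> nat \<Rightarrow> nat) \<Rightarrow> (nat \<Rightarrow> nat \<Rightarrow> nat) \<Rightarrow> (nat \<Rightarrow> nat \<Rightarrow> 'a::real_normed_vector) \<Rightarrow> nat \<Rightarrow> nat \<Rightarrow> 'a" where
  "Delta_E_MC M dM v i l = (1 / real (dM i l)) *\<^sub>R (\<Sum>m = 1 + M (i - 1) l..M i l. v l m)"

definition Delta_z2 :: "(nat \<Rightarrow> nat \<Rightarrow> nat) \<Rightarrow> (nat \<Rightarrow> nat \<Rightarrow> nat) \<Rightarrow> (nat \<Rightarrow> nat \<Rightarrow> 'a::real_normed_vector) \<Rightarrow> nat \<Rightarrow> nat \<Rightarrow> real" where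
  "Delta_z2 M dM v i l = (\<Sum>m = 1 + M (i - 1) l..M i l. (norm (v l m - Delta_E_MC M dM v i l))\<^sup>2)"

definition delta :: "(nat \<Rightarrow> nat \<Rightarrow> nat) \<Rightarrow> (nat \<Rightarrow> nat \<Rightarrow> nat) \<Rightarrow> (nat \<Rightarrow> nat \<Rightarrow> 'a::real_normed_vector) \<Rightarrow> nat \<Rightarrow> nat \<Rightarrow> 'a" where
  "delta M dM v i l = Delta_E_MC M dM v i l - E_MC M v (i - 1) l"

end

theory Submission
  imports Defs
begin

text \<open>
  Split the sum of squared deviations from the new mean \<open>e\<close> into old and new samples, and shift
  each block to its own mean (\<open>a\<close> and \<open>b\<close>). With \<open>p\<close> old and \<open>q\<close> new samples
  the shifts cost \<open>p \<parallel>a - e\<parallel>\<^sup>2 + q \<parallel>b - e\<parallel>\<^sup>2\<close>, and since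
  \<open>(p + q) e = p a + q b\<close> this equals \<open>p q / (p + q) \<parallel>b - a\<parallel>\<^sup>2\<close>.
\<close>

text \<open>Expanding the square around \<open>\<mu>\<close> leaves a cross term that is the inner
  product of \<open>\<mu> - c\<close> with the sum of all deviations from \<open>\<mu>\<close>, and
  that sum is zero. The mean is given without division, so an empty block is covered.\<close>

lemma sum_norm_diff_shift_to_mean:
  fixes f :: "'b \<Rightarrow> 'a::real_inner"
  assumes mean: "(\<Sum>x\<in>A. f x) = real (card A) *\<^sub>R \<mu>"
  shows "(\<Sum>x\<in>A. (norm (f x - c))\<^sup>2) =
    (\<Sum>x\<in>A. (norm (f x - \<mu>))\<^sup>2) + real (card A) * (norm (\<mu> - c))\<^sup>2"
proof -
  have "(\<Sum>x\<in>A. inner (f x - \<mu>) (\<mu> - c)) = inner (\<Sum>x\<in>A. f x - \<mu>) (\<mu> - c)"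
    by (simp add: inner_sum_left)
  also have "\<dots> = 0"
    by (simp add: sum_subtractf mean sum_constant_scaleR)
  finally have cross: "(\<Sum>x\<in>A. inner (f x - \<mu>) (\<mu> - c)) = 0" .
  have "(norm (f x - c))\<^sup>2 =
      (norm (f x - \<mu>))\<^sup>2 + 2 * inner (f x - \<mu>) (\<mu> - c) + (norm (\<mu> - c))\<^sup>2" for x
    by (simp add: power2_norm_eq_inner inner_diff inner_commute)
  then show ?thesis
    by (simp add: sum.distrib sum_distrib_left [symmetric] cross)
qed

text \<open>The barycentre lies on the line through \<open>a\<close> and \<open>b\<close>:
  \<open>a - e\<close> and \<open>b - e\<close> are the multiples \<open>-q/(p+q)\<close> and
  \<open>p/(p+q)\<close> of \<open>b - a\<close>. The weights may have any sign, hence the absolute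
  values in the proof.\<close>

lemma weighted_norm_diff_barycentre:
  fixes a b e :: "'a::real_normed_vector"
  assumes "p + q \<noteq> 0" and bary: "(p + q) *\<^sub>R e = p *\<^sub>R a + q *\<^sub>R b"
  shows "p * (norm (a - e))\<^sup>2 + q * (norm (b - e))\<^sup>2 = (p * q / (p + q)) * (norm (b - a))\<^sup>2"
proof -
  have "(p + q) *\<^sub>R (a - e) = - q *\<^sub>R (b - a)" and "(p + q) *\<^sub>R (b - e) = p *\<^sub>R (b - a)"
    unfolding scaleR_diff_right bary by (simp_all add: algebra_simps)
  then have "\<bar>p + q\<bar> * norm (a - e) = \<bar>q\<bar> * norm (b - a)"
    and "\<bar>p + q\<bar> * norm (b - e) = \<bar>p\<bar> * norm (b - a)"
    by (metis norm_scaleR abs_minus_cancel)+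
  then have "(p + q)\<^sup>2 * (norm (a - e))\<^sup>2 = q\<^sup>2 * (norm (b - a))\<^sup>2"
    and "(p + q)\<^sup>2 * (norm (b - e))\<^sup>2 = p\<^sup>2 * (norm (b - a))\<^sup>2"
    by (metis power_mult_distrib power2_abs)+
  then have "(p + q)\<^sup>2 * (p * (norm (a - e))\<^sup>2 + q * (norm (b - e))\<^sup>2) =
      p * (q\<^sup>2 * (norm (b - a))\<^sup>2) + q * (p\<^sup>2 * (norm (b - a))\<^sup>2)"
    by (simp add: distrib_left mult.left_commute)
  \<comment> \<open>Here \<open>p * q^2 + q * p^2 = p * q * (p + q)\<close>, so one factor
    \<open>p + q\<close> survives in the denominator.\<close>
  also have "\<dots> = (p + q)\<^sup>2 * ((p * q / (p + q)) * (norm (b - a))\<^sup>2)"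
    using \<open>p + q \<noteq> 0\<close> by (simp add: divide_simps) (simp add: algebra_simps power2_eq_square)
  finally show ?thesis
    using \<open>p + q \<noteq> 0\<close> by (simp only: mult_cancel_left) simp
qed

theorem lemma3p4:
  fixes v :: "nat \<Rightarrow> nat \<Rightarrow> 'a::{real_inner, complete_space}"
    and M dM :: "nat \<Rightarrow> nat \<Rightarrow> nat"
    and i l :: nat
  assumes "i \<ge> 1"
    and "M (i - 1) l \<ge> 1"
    and "dM i l \<ge> 1"
    and "M i l = M (i - 1) l + dM i l"
  shows "z2 M v i l =
    z2 M v (i - 1) l + Delta_z2 M dM v i l
      + (real (M (i - 1) l) * real (dM i l) / real (M i l)) * (norm (delta M dM v i l))\<^sup>2"
proof -
  let ?p = "M (i - 1) l" and ?q = "dM i l" and ?N = "M i l"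
  let ?a = "E_MC M v (i - 1) l" and ?b = "Delta_E_MC M dM v i l" and ?e = "E_MC M v i l"
  \<comment> \<open>Polymorphic in the summands, to split both the vector sum of the samples and the
    real sum of squares.\<close>
  have split: "(\<Sum>m = 1..?N. f m) = (\<Sum>m = 1..?p. f m) + (\<Sum>m = 1 + ?p..?N. f m)"
    for f :: "nat \<Rightarrow> 'b::comm_monoid_add"
    using sum.ub_add_nat [of 1 ?p f ?q] assms(4) by simp
  have old: "(\<Sum>m = 1..?p. v l m) = real (card {1..?p}) *\<^sub>R ?a"
    using assms(2) by (simp add: E_MC_def)
  have new: "(\<Sum>m = 1 + ?p..?N. v l m) = real (card {1 + ?p..?N}) *\<^sub>R ?b"
    using assms(3,4) by (simp add: Delta_E_MC_def)
  have "real ?N *\<^sub>R ?e = (\<Sum>m = 1..?N. v l m)"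
    using assms(3,4) by (simp add: E_MC_def)
  also have "\<dots> = real ?p *\<^sub>R ?a + real ?q *\<^sub>R ?b"
    unfolding split old new using assms(4) by simp
  finally have bary: "(real ?p + real ?q) *\<^sub>R ?e = real ?p *\<^sub>R ?a + real ?q *\<^sub>R ?b"
    using assms(4) by simp
  have "z2 M v i l = z2 M v (i - 1) l + Delta_z2 M dM v i l
      + (real ?p * (norm (?a - ?e))\<^sup>2 + real ?q * (norm (?b - ?e))\<^sup>2)"
    unfolding z2_def Delta_z2_def split
      sum_norm_diff_shift_to_mean [OF old, of ?e] sum_norm_diff_shift_to_mean [OF new, of ?e]
    using assms(4) by simp
  also have "real ?p * (norm (?a - ?e))\<^sup>2 + real ?q * (norm (?b - ?e))\<^sup>2 =
      (real ?p * real ?q / real ?N) * (norm (delta M dM v i l))\<^sup>2"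
    using weighted_norm_diff_barycentre [OF _ bary] assms(3,4) by (simp add: delta_def)
  finally show ?thesis .
qed

end
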